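(* Let $N \in \mathbb{N}$ and suppose that $A$ is an arithmetic progression of length $N$ in $\mathbb{Z}$. Then $A$ is not $N$-stable (in $\mathbb{Z}$).
   Context: $\mathbb{N}=\{1,2,3,\dots\}$. An arithmetic progression of length $N$ in $\mathbb{Z}$ is a set of the form $\{x,x+d,\dots,x+(N-1)d\}$ with $x,d \in \mathbb{Z}$ and $d \neq 0$ (so it has exactly $N$ elements). Let $G$ be an Abelian group, $A \subset G$ and $k \in \mathbb{N}$. The set $A$ has the $k$-order property (in $G$) if there are vectors $s=(s_1,\dots,s_k)$ and $t=(t_1,\dots,t_k)$ in $G^k$ such that for all $1 \leq i,j \leq k$ one has $s_i+t_j \in A$ if and only if $i \leq j$. The set $A$ is $k$-stable (in $G$) if it does not have the $k$-order property. *)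

theory Defs
  imports Main
begin

definition arithmetic_progression :: "nat \<Rightarrow> int set \<Rightarrow> bool" where
  "arithmetic_progression N A \<longleftrightarrow>
     (\<exists>x d :: int. d \<noteq> 0 \<and> A = {x + int i * d | i. i < N})"

(* The group G is the type 'a. Vectors in G^k are functions on nat of which only
   the values at 1, ..., k matter. *)
definition k_order_property :: "nat \<Rightarrow> 'a :: ab_group_add set \<Rightarrow> bool" where
  "k_order_property k A \<longleftrightarrow>
     (\<exists>s t :: nat \<Rightarrow> 'a. \<forall>i\<in>{1..k}. \<forall>j\<in>{1..k}. s i + t j \<in> A \<longleftrightarrow> i \<le> j)"

definition k_stable :: "nat \<Rightarrow> 'a :: ab_group_add set \<Rightarrow> bool" where
  "k_stable k A \<longleftrightarrow> \<not> k_order_property k A"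

end

theory Submission
  imports Defs
begin

text \<open>Let \<open>s\<close> run down and \<open>t\<close> run up in steps of \<open>d\<close>,
  so that \<open>s i + t j = x + (j - i) * d\<close> depends only on the difference of the indices.
  For indices in \<open>{1..N}\<close> this difference is at most \<open>N - 1\<close>, so the sum
  lies in the progression exactly when the difference is nonnegative.\<close>

theorem proposition1p2:
  fixes N :: nat and A :: "int set"
  assumes "N \<ge> 1" and "arithmetic_progression N A"
  shows "\<not> k_stable N A"
proof -
  obtain x d :: int where d: "d \<noteq> 0" and A: "A = {x + int i * d | i. i < N}"
    using assms(2) unfolding arithmetic_progression_def by blast
  have "(x - int i * d) + int j * d \<in> A \<longleftrightarrow> i \<le> j"
    if "i \<in> {1..N}" "j \<in> {1..N}" for i j
  proof
    assume "(x - int i * d) + int j * d \<in> A"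
    then obtain m where "(x - int i * d) + int j * d = x + int m * d"
      by (auto simp: A)
    then have "int j * d = (int i + int m) * d"
      by (simp add: algebra_simps)
    \<comment> \<open>Cancelling \<open>d\<close> leaves \<open>j = i + m\<close> with
      \<open>m\<close> a natural number.\<close>
    then show "i \<le> j"
      using d by simp
  next
    assume "i \<le> j"
    then have "(x - int i * d) + int j * d = x + int (j - i) * d"
      by (simp add: of_nat_diff algebra_simps)
    \<comment> \<open>Strict because indices start at 1: \<open>j - i\<close> is at most
      \<open>N - 1\<close>, the last index of the progression.\<close>
    moreover have "j - i < N"
      using that by auto
    ultimately show "(x - int i * d) + int j * d \<in> A"
      unfolding A mem_Collect_eq by (intro exI conjI)
  qed
  then have "k_order_property N A"
    unfolding k_order_property_def
    by (intro exI[of _ "\<lambda>i. x - int i * d"] exI[of _ "\<lambda>j. int j * d"] ballI)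
  then show ?thesis
    unfolding k_stable_def by simp
qed

end
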